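(* Let $\mu$ be a probability density on $[q]^n\times[q]^n$ such that $H_\infty(\mu_I)\ge1.9\log q\cdot|I|-t$ for all $I\subseteq[n]$. Then for all $d\in\mathbb N$ there exists a partition $[q]^n\times[q]^n=\left(\bigcup_{i\in[N]}\mathcal R_i\right)\cup\mathsf{Error}$, where $\mathcal R_i=\mathcal A_i\times\mathcal B_i$ are combinatorial rectangles ($\mathcal A_i,\mathcal B_i\subseteq[q]^n$), such that (1) for each $i\in[N]$, if $(X_i,Y_i)\sim\mu$ conditioned on $\mathcal R_i$, then $X_i,Y_i$ are aligned $d$-CBD; and (2) $\mu(\mathsf{Error})\le2^t\cdot(d\,q^{-0.05})^d$.
   Context: Logarithms base 2. A density on a finite domain $\mathcal D$ is $\mu\ge0$ with uniform average $1$; $Z\sim\mu$ means $\Pr[Z=z]=\mu(z)/|\mathcal D|$; $\mu(S)=\Pr_{Z\sim\mu}[Z\in S]$. For $I\subseteq[n]$, $\mu_I$ is the density on $[q]^I\times[q]^I$ of $(X_I,Y_I)$ where $(X,Y)\sim\mu$ and $X_I$ denotes projection to coordinates in $I$; $H_\infty(\mu_I)=\min\log(q^{2|I|}/\mu_I(x,y))$. For a random variable $Z$, $H_\infty(Z)=\min_z\log(1/\Pr[Z=z])$. A random variable $X$ on $[q]^n$ is $d$-CBD if there is $I\subseteq[n]$, $|I|\le d$, with $X_I$ constant and $H_\infty(X_J)\ge0.8\log q\cdot|J|$ for every $J\subseteq[n]\setminus I$; two $d$-CBD random variables are aligned if they have the same such set $I$. *)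

theory Defs
  imports Complex_Main "HOL-Library.FuncSet" "HOL-Library.Extended_Real"
begin

text \<open>The cube [q]^I, coordinates in I, values in {0..<q} (0-indexed).
  Points outside I are fixed to undefined (extensional functions).\<close>
definition cube :: "nat set \<Rightarrow> nat \<Rightarrow> (nat \<Rightarrow> nat) set" where
  "cube I q = PiE I (\<lambda>_. {0..<q})"

definition dom2 :: "nat set \<Rightarrow> nat \<Rightarrow> ((nat \<Rightarrow> nat) \<times> (nat \<Rightarrow> nat)) set" where
  "dom2 I q = cube I q \<times> cube I q"

definition is_density :: "'a set \<Rightarrow> ('a \<Rightarrow> real) \<Rightarrow> bool" where
  "is_density D \<mu> \<longleftrightarrow> (\<forall>z\<in>D. 0 \<le> \<mu> z) \<and> (\<Sum>z\<in>D. \<mu> z) / real (card D) = 1"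

text \<open>mu(S) = Pr_{Z ~ mu}[Z in S], where Pr[Z = z] = mu(z)/|D|.\<close>
definition dprob :: "'a set \<Rightarrow> ('a \<Rightarrow> real) \<Rightarrow> 'a set \<Rightarrow> real" where
  "dprob D \<mu> S = (\<Sum>z\<in>D \<inter> S. \<mu> z) / real (card D)"

definition Hinf_dens :: "'a set \<Rightarrow> ('a \<Rightarrow> real) \<Rightarrow> ereal" where
  "Hinf_dens D \<mu> = (INF z\<in>D. if \<mu> z = 0 then \<infinity> else ereal (log 2 (real (card D) / \<mu> z)))"

definition Hinf_rv :: "'a set \<Rightarrow> ('a \<Rightarrow> real) \<Rightarrow> ereal" where
  "Hinf_rv S p = (INF z\<in>S. if p z = 0 then \<infinity> else ereal (log 2 (1 / p z)))"

definition marg :: "nat \<Rightarrow> nat \<Rightarrow> ((nat \<Rightarrow> nat) \<times> (nat \<Rightarrow> nat) \<Rightarrow> real) \<Rightarrow> nat set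
    \<Rightarrow> (nat \<Rightarrow> nat) \<times> (nat \<Rightarrow> nat) \<Rightarrow> real" where
  "marg n q \<mu> I xy = real (card (dom2 I q)) *
     dprob (dom2 {0..<n} q) \<mu> {(a, b). restrict a I = fst xy \<and> restrict b I = snd xy}"

definition condX :: "nat \<Rightarrow> nat \<Rightarrow> ((nat \<Rightarrow> nat) \<times> (nat \<Rightarrow> nat) \<Rightarrow> real)
    \<Rightarrow> ((nat \<Rightarrow> nat) \<times> (nat \<Rightarrow> nat)) set \<Rightarrow> (nat \<Rightarrow> nat) \<Rightarrow> real" where
  "condX n q \<mu> R x = dprob (dom2 {0..<n} q) \<mu> (R \<inter> {(a, b). a = x}) / dprob (dom2 {0..<n} q) \<mu> R"

definition condY :: "nat \<Rightarrow> nat \<Rightarrow> ((nat \<Rightarrow> nat) \<times> (nat \<Rightarrow> nat) \<Rightarrow> real)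
    \<Rightarrow> ((nat \<Rightarrow> nat) \<times> (nat \<Rightarrow> nat)) set \<Rightarrow> (nat \<Rightarrow> nat) \<Rightarrow> real" where
  "condY n q \<mu> R y = dprob (dom2 {0..<n} q) \<mu> (R \<inter> {(a, b). b = y}) / dprob (dom2 {0..<n} q) \<mu> R"

definition proj_pmf :: "nat \<Rightarrow> nat \<Rightarrow> ((nat \<Rightarrow> nat) \<Rightarrow> real) \<Rightarrow> nat set \<Rightarrow> (nat \<Rightarrow> nat) \<Rightarrow> real" where
  "proj_pmf n q p J z = (\<Sum>x\<in>{x\<in>cube {0..<n} q. restrict x J = z}. p x)"

definition CBD_wrt :: "nat \<Rightarrow> nat \<Rightarrow> nat \<Rightarrow> ((nat \<Rightarrow> nat) \<Rightarrow> real) \<Rightarrow> nat set \<Rightarrow> bool" where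
  "CBD_wrt d n q p I \<longleftrightarrow> I \<subseteq> {0..<n} \<and> card I \<le> d
     \<and> (\<exists>c. \<forall>x\<in>cube {0..<n} q. p x \<noteq> 0 \<longrightarrow> restrict x I = c)
     \<and> (\<forall>J. J \<subseteq> {0..<n} - I \<longrightarrow>
           Hinf_rv (cube J q) (proj_pmf n q p J) \<ge> ereal (0.8 * log 2 (real q) * real (card J)))"

definition is_CBD :: "nat \<Rightarrow> nat \<Rightarrow> nat \<Rightarrow> ((nat \<Rightarrow> nat) \<Rightarrow> real) \<Rightarrow> bool" where
  "is_CBD d n q p \<longleftrightarrow> (\<exists>I. CBD_wrt d n q p I)"

definition aligned_CBD :: "nat \<Rightarrow> nat \<Rightarrow> nat \<Rightarrow> ((nat \<Rightarrow> nat) \<Rightarrow> real) \<Rightarrow> ((nat \<Rightarrow> nat) \<Rightarrow> real) \<Rightarrow> bool" where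
  "aligned_CBD d n q p p' \<longleftrightarrow> (\<exists>I. CBD_wrt d n q p I \<and> CBD_wrt d n q p' I)"

end

theory Submission
  imports Defs "HOL-Library.Disjoint_Sets"
begin

text \<open>
  A rectangle on which both sides are constant on \<open>I\<close> has mass at most \<open>2\<^sup>t q\<close> to the power
  \<open>-1.9 |I|\<close>. If it is not acceptable, some event \<open>X\<^sub>J = x\<close> (or \<open>Y\<^sub>J = y\<close>) has conditional
  probability above \<open>q\<close> to the power \<open>-0.8 |J|\<close>. Split this event off, partition it according
  to the other side's values on \<open>J\<close>, recurse on these pieces with budget \<open>d - |J|\<close>, and continue
  with the remaining rectangle. Once the remaining mass is a factor \<open>q\<close> to the power \<open>-0.1 d\<close>
  below the a priori bound, everything that is left is declared an error; before that point only
  sets with \<open>|J| < d\<close> can occur. All exponents are multiples of 0.05, so everything is expressed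
  in natural powers of \<open>v\<close>, the inverse twentieth root of \<open>q\<close>.
\<close>

section \<open>Constancy on coordinates, and elementary estimates\<close>

text \<open>Constancy is stated pairwise, without naming the common value, so that it passes to
  subsets and holds for empty pieces.\<close>

definition agree :: "(nat \<Rightarrow> nat) set \<Rightarrow> nat set \<Rightarrow> bool" where
  "agree A I \<longleftrightarrow> (\<forall>x\<in>A. \<forall>y\<in>A. \<forall>i\<in>I. x i = y i)"

lemma agree_subset: "agree A I \<Longrightarrow> B \<subseteq> A \<Longrightarrow> agree B I"
  unfolding agree_def by blast

lemma agree_Un: "agree A I \<Longrightarrow> agree A J \<Longrightarrow> agree A (I \<union> J)"
  unfolding agree_def by blast

lemma agree_restrict: "agree {a \<in> A. restrict a J = x} J"
  unfolding agree_def by (metis (mono_tags, lifting) mem_Collect_eq restrict_apply')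

lemma agree_restrict_eq: "agree A I \<Longrightarrow> a \<in> A \<Longrightarrow> b \<in> A \<Longrightarrow> restrict a I = restrict b I"
  unfolding agree_def restrict_def by (rule ext) auto

lemma finite_cube: "finite I \<Longrightarrow> finite (cube I q)"
  unfolding cube_def by (intro finite_PiE) auto

lemma card_cube: "finite I \<Longrightarrow> card (cube I q) = q ^ card I"
  unfolding cube_def by (simp add: card_PiE)

lemma restrict_in_cube: "x \<in> cube K q \<Longrightarrow> I \<subseteq> K \<Longrightarrow> restrict x I \<in> cube I q"
  unfolding cube_def by (intro restrict_PiE_iff[THEN iffD2]) auto

text \<open>With \<open>e = d - 1\<close>, the first two binomial terms of
  \<open>(e + 1) ^ d\<close> are \<open>e ^ d + d * e ^ (d - 1) = (2 * e + 1) * e ^ e\<close>, and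
  \<open>1 \<le> e ^ e\<close>. This is the numerical inequality behind
  \<open>err_recursion\<close>.\<close>

lemma double_pow_le_pow:
  assumes "2 \<le> (d::nat)"
  shows "1 + 2 * (real d - 1) * (real d - 1) ^ (d - 1) \<le> real d ^ d"
proof -
  define e where "e = d - 1"
  have d: "d = Suc e" "1 \<le> e" using assms by (auto simp: e_def)
  have mono: "real e ^ j + real j * real e ^ (j - 1) \<le> real (Suc e) ^ j" for j
  proof (induction j)
    case (Suc j)
    have "real e ^ Suc j + real (Suc j) * real e ^ (Suc j - 1)
        \<le> (real e ^ j + real j * real e ^ (j - 1)) * real (Suc e)"
      by (cases j) (auto simp: algebra_simps)
    also have "\<dots> \<le> real (Suc e) ^ j * real (Suc e)"
      by (intro mult_right_mono Suc) auto
    finally show ?case by (simp add: mult.commute)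
  qed auto
  have "1 \<le> real e ^ e" using d(2) by simp
  then have "1 + 2 * real e * real e ^ e \<le> real e ^ d + real d * real e ^ (d - 1)"
    using d(1) by (simp add: algebra_simps)
  also have "\<dots> \<le> real d ^ d" using mono[of d] d(1) by simp
  finally show ?thesis using d(1) by simp
qed

lemma ln_ge_diff_quotient:
  assumes "0 < c" "c < (m::real)"
  shows "c / m \<le> ln m - ln (m - c)"
proof -
  have "ln ((m - c) / m) \<le> (m - c) / m - 1"
    using assms by (intro ln_le_minus_one) auto
  then show ?thesis using assms by (simp add: ln_div field_simps)
qed

section \<open>Mass of sets, and partial partitions into acceptable rectangles\<close>

text \<open>\<open>d0\<close> is the bound on the number of fixed coordinates in the final
  rectangles; it stays the same while the recursion spends its own budget.\<close>

locale weighted_square =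
  fixes n q d0 :: nat and \<mu> :: "(nat \<Rightarrow> nat) \<times> (nat \<Rightarrow> nat) \<Rightarrow> real"
  assumes nonneg: "\<And>z. z \<in> dom2 {0..<n} q \<Longrightarrow> 0 \<le> \<mu> z"
begin

abbreviation P :: "((nat \<Rightarrow> nat) \<times> (nat \<Rightarrow> nat)) set \<Rightarrow> real" where
  "P \<equiv> dprob (dom2 {0..<n} q) \<mu>"

abbreviation C :: "(nat \<Rightarrow> nat) set" where
  "C \<equiv> cube {0..<n} q"

lemma finite_dom: "finite (dom2 {0..<n} q)"
  unfolding dom2_def by (simp add: finite_cube)

lemma P_nonneg: "0 \<le> P S"
  unfolding dprob_def by (intro divide_nonneg_nonneg sum_nonneg) (auto intro: nonneg)

lemma P_empty [simp]: "P {} = 0"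
  unfolding dprob_def by simp

lemma P_mono: "S \<subseteq> S' \<Longrightarrow> P S \<le> P S'"
  unfolding dprob_def
  by (intro divide_right_mono sum_mono2) (auto intro: nonneg finite_dom)

lemma P_Un: "S \<inter> S' = {} \<Longrightarrow> P (S \<union> S') = P S + P S'"
  unfolding dprob_def Int_Un_distrib
  by (subst sum.union_disjoint) (auto simp: add_divide_distrib finite_dom)

lemma P_UN:
  "finite Z \<Longrightarrow> (\<And>y z. y \<in> Z \<Longrightarrow> z \<in> Z \<Longrightarrow> y \<noteq> z \<Longrightarrow> S y \<inter> S z = {}) \<Longrightarrow>
     P (\<Union>z\<in>Z. S z) = (\<Sum>z\<in>Z. P (S z))"
proof (induction Z rule: finite_induct)
  case (insert y Z)
  have "S y \<inter> (\<Union>z\<in>Z. S z) = {}"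
    using insert.prems insert.hyps by blast
  moreover have "P (\<Union>z\<in>Z. S z) = (\<Sum>z\<in>Z. P (S z))"
    by (rule insert.IH) (use insert.prems in auto)
  ultimately show ?case
    using insert.hyps by (simp add: P_Un)
qed auto

text \<open>The rectangles allowed in the final partition. Positive mass makes the conditioning
  meaningful. The aligned set \<open>I\<close> is hidden, so that rectangles with different fixed
  coordinates can be collected in one family.\<close>

definition Acc :: "((nat \<Rightarrow> nat) \<times> (nat \<Rightarrow> nat)) set set" where
  "Acc = {A \<times> B | A B. A \<subseteq> C \<and> B \<subseteq> C \<and> 0 < P (A \<times> B)
            \<and> aligned_CBD d0 n q (condX n q \<mu> (A \<times> B)) (condY n q \<mu> (A \<times> B))}"

text \<open>\<open>e\<close> bounds the mass left uncovered. \<open>R\<close> may be any set, so a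
  union of recursively treated pieces counts as one region, and the errors of disjoint regions add
  up.\<close>

definition good :: "((nat \<Rightarrow> nat) \<times> (nat \<Rightarrow> nat)) set \<Rightarrow> real \<Rightarrow> bool" where
  "good R e \<longleftrightarrow> (\<exists>F. finite F \<and> F \<subseteq> Acc \<and> disjoint F \<and> \<Union>F \<subseteq> R \<and> P (R - \<Union>F) \<le> e)"

lemma good_self: "good R (P R)"
  unfolding good_def by (intro exI[of _ "{}"]) auto

lemma good_mono: "good R e \<Longrightarrow> e \<le> e' \<Longrightarrow> good R e'"
  unfolding good_def by (meson order.trans)

lemma good_Acc: "R \<in> Acc \<Longrightarrow> good R 0"
  unfolding good_def by (intro exI[of _ "{R}"]) auto

lemma good_Un:
  assumes "good R e" "good S e'" "R \<inter> S = {}"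
  shows "good (R \<union> S) (e + e')"
proof -
  obtain F where F: "finite F" "F \<subseteq> Acc" "disjoint F" "\<Union>F \<subseteq> R" "P (R - \<Union>F) \<le> e"
    using assms(1) unfolding good_def by blast
  obtain G where G: "finite G" "G \<subseteq> Acc" "disjoint G" "\<Union>G \<subseteq> S" "P (S - \<Union>G) \<le> e'"
    using assms(2) unfolding good_def by blast
  have dj: "\<Union>F \<inter> \<Union>G = {}" using F(4) G(4) assms(3) by blast
  have "(R \<union> S) - \<Union>(F \<union> G) = (R - \<Union>F) \<union> (S - \<Union>G)"
    using F(4) G(4) assms(3) by blast
  then have "P ((R \<union> S) - \<Union>(F \<union> G)) = P (R - \<Union>F) + P (S - \<Union>G)"
    using assms(3) by (subst P_Un[symmetric]) auto
  then show ?thesis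
    unfolding good_def using F G disjoint_union[OF F(3) G(3) dj]
    by (intro exI[of _ "F \<union> G"]) auto
qed

lemma good_UN:
  "finite Z \<Longrightarrow> (\<And>z. z \<in> Z \<Longrightarrow> good (S z) e) \<Longrightarrow>
   (\<And>y z. y \<in> Z \<Longrightarrow> z \<in> Z \<Longrightarrow> y \<noteq> z \<Longrightarrow> S y \<inter> S z = {}) \<Longrightarrow>
     good (\<Union>z\<in>Z. S z) (real (card Z) * e)"
proof (induction Z rule: finite_induct)
  case empty
  then show ?case using good_self[of "{}"] by simp
next
  case (insert y Z)
  have "S y \<inter> (\<Union>z\<in>Z. S z) = {}"
    using insert.prems(2) insert.hyps by blast
  moreover have "good (\<Union>z\<in>Z. S z) (real (card Z) * e)"
    by (rule insert.IH) (use insert.prems in auto)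
  ultimately have "good (S y \<union> (\<Union>z\<in>Z. S z)) (e + real (card Z) * e)"
    by (intro good_Un insert.prems(1)) auto
  then show ?case
    using insert.hyps by (simp add: algebra_simps)
qed

text \<open>The fibres \<open>a = x\<close> over all \<open>x\<close> that restrict to
  \<open>z\<close> tile a subrectangle. Conditional marginals thereby become quotients of rectangle
  masses, which are all that the recursion handles.\<close>

lemma proj_condX:
  assumes "A \<subseteq> C" "B \<subseteq> C"
  shows "proj_pmf n q (condX n q \<mu> (A \<times> B)) J z
           = P ({a \<in> A. restrict a J = z} \<times> B) / P (A \<times> B)"
proof -
  define Z where "Z = {x \<in> C. restrict x J = z}"
  have "finite Z" unfolding Z_def by (simp add: finite_cube)
  then have "(\<Sum>x\<in>Z. P ((A \<times> B) \<inter> {(a, b). a = x})) = P (\<Union>x\<in>Z. (A \<times> B) \<inter> {(a, b). a = x})"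
    by (subst P_UN) auto
  also have "(\<Union>x\<in>Z. (A \<times> B) \<inter> {(a, b). a = x}) = {a \<in> A. restrict a J = z} \<times> B"
    using assms unfolding Z_def by auto
  finally show ?thesis
    unfolding proj_pmf_def condX_def Z_def[symmetric] sum_divide_distrib[symmetric] by simp
qed

lemma proj_condY:
  assumes "A \<subseteq> C" "B \<subseteq> C"
  shows "proj_pmf n q (condY n q \<mu> (A \<times> B)) J z
           = P (A \<times> {b \<in> B. restrict b J = z}) / P (A \<times> B)"
proof -
  define Z where "Z = {x \<in> C. restrict x J = z}"
  have "finite Z" unfolding Z_def by (simp add: finite_cube)
  then have "(\<Sum>x\<in>Z. P ((A \<times> B) \<inter> {(a, b). b = x})) = P (\<Union>x\<in>Z. (A \<times> B) \<inter> {(a, b). b = x})"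
    by (subst P_UN) auto
  also have "(\<Union>x\<in>Z. (A \<times> B) \<inter> {(a, b). b = x}) = A \<times> {b \<in> B. restrict b J = z}"
    using assms unfolding Z_def by auto
  finally show ?thesis
    unfolding proj_pmf_def condY_def Z_def[symmetric] sum_divide_distrib[symmetric] by simp
qed

text \<open>Replaces the extended-real infimum by a bound on each point probability; points of
  probability zero contribute \<open>\<infinity>\<close> and impose no constraint.\<close>

lemma CBD_wrtI:
  assumes "I \<subseteq> {0..<n}" "card I \<le> d0" "agree A I"
    and "\<And>x. x \<notin> A \<Longrightarrow> p x = 0"
    and nn: "\<And>J z. 0 \<le> proj_pmf n q p J z"
    and le: "\<And>J z. J \<subseteq> {0..<n} - I \<Longrightarrow>
          proj_pmf n q p J z \<le> 2 powr (- (0.8 * log 2 (real q) * real (card J)))"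
  shows "CBD_wrt d0 n q p I"
  unfolding CBD_wrt_def
proof (intro conjI allI impI)
  show "\<exists>c. \<forall>x\<in>C. p x \<noteq> 0 \<longrightarrow> restrict x I = c"
    using assms(3,4) agree_restrict_eq by metis
next
  fix J assume J: "J \<subseteq> {0..<n} - I"
  show "ereal (0.8 * log 2 (real q) * real (card J)) \<le> Hinf_rv (cube J q) (proj_pmf n q p J)"
    unfolding Hinf_rv_def
  proof (intro INF_greatest)
    fix z
    let ?r = "proj_pmf n q p J z" and ?c = "0.8 * log 2 (real q) * real (card J)"
    have "?c \<le> log 2 (1 / ?r)" if "?r \<noteq> 0"
    proof -
      have pos: "0 < ?r" using nn[of J z] that by simp
      then have "log 2 ?r \<le> - ?c"
        using le[OF J, of z] by (simp add: log_le_iff)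
      then show ?thesis using pos by (simp add: log_divide)
    qed
    then show "ereal ?c \<le> (if ?r = 0 then \<infinity> else ereal (log 2 (1 / ?r)))"
      by simp
  qed
qed (use assms in auto)

text \<open>Meant for contrapositive use: if such a rectangle is not acceptable, some
  \<open>J\<close> and \<open>z\<close> violate \<open>X\<close> or \<open>Y\<close>, which exhibits
  a heavy event to split off.\<close>

lemma mem_AccI:
  assumes sub: "A \<subseteq> C" "B \<subseteq> C" and I: "I \<subseteq> {0..<n}" "card I \<le> d0" "agree A I" "agree B I"
    and pos: "0 < P (A \<times> B)"
    and X: "\<And>J z. J \<subseteq> {0..<n} - I \<Longrightarrow> P ({a \<in> A. restrict a J = z} \<times> B)
              \<le> P (A \<times> B) * 2 powr (- (0.8 * log 2 (real q) * real (card J)))"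
    and Y: "\<And>J z. J \<subseteq> {0..<n} - I \<Longrightarrow> P (A \<times> {b \<in> B. restrict b J = z})
              \<le> P (A \<times> B) * 2 powr (- (0.8 * log 2 (real q) * real (card J)))"
  shows "A \<times> B \<in> Acc"
proof -
  have "CBD_wrt d0 n q (condX n q \<mu> (A \<times> B)) I"
  proof (rule CBD_wrtI[OF I(1,2,3)])
    fix x assume "x \<notin> A"
    then have "(A \<times> B) \<inter> {(a, b). a = x} = {}" by auto
    then show "condX n q \<mu> (A \<times> B) x = 0" by (simp add: condX_def)
  qed (use X pos P_nonneg in \<open>auto simp: proj_condX[OF sub] divide_le_eq mult.commute\<close>)
  moreover have "CBD_wrt d0 n q (condY n q \<mu> (A \<times> B)) I"
  proof (rule CBD_wrtI[OF I(1,2,4)])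
    fix x assume "x \<notin> B"
    then have "(A \<times> B) \<inter> {(a, b). b = x} = {}" by auto
    then show "condY n q \<mu> (A \<times> B) x = 0" by (simp add: condY_def)
  qed (use Y pos P_nonneg in \<open>auto simp: proj_condY[OF sub] divide_le_eq mult.commute\<close>)
  ultimately show ?thesis
    unfolding Acc_def aligned_CBD_def using sub pos by blast
qed

end

section \<open>Splitting heavy events off spread rectangles\<close>

text \<open>\<open>T\<close> stands for \<open>2 powr t\<close>. Since \<open>v\<close> is
  \<open>q\<close> to the power -0.05, the exponent 38 is 20 times the entropy rate 1.9.\<close>

locale spread_square = weighted_square +
  fixes T v :: real
  assumes T: "0 < T" and v: "0 < v" "v \<le> 1" and qv: "real q * v ^ 20 = 1"
    and spread: "\<And>A B I. A \<subseteq> C \<Longrightarrow> B \<subseteq> C \<Longrightarrow> I \<subseteq> {0..<n} \<Longrightarrow> agree A I \<Longrightarrow> agree B I \<Longrightarrow>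
           P (A \<times> B) \<le> T * v ^ (38 * card I)"
begin

text \<open>The exponent 16 is 20 times the rate 0.8 in the definition of CBD.\<close>

lemma entropy_threshold: "2 powr (- (0.8 * log 2 (real q) * real k)) = v ^ (16 * k)"
proof -
  have "real q = v powr (-20)"
    using qv v by (simp add: powr_minus powr_realpow field_simps)
  then have "log 2 (real q) = -20 * log 2 v"
    using v by (simp add: log_powr)
  then have "2 powr (- (0.8 * log 2 (real q) * real k)) = 2 powr (log 2 v * real (16 * k))"
    by (simp add: algebra_simps)
  also have "\<dots> = (2 powr log 2 v) powr real (16 * k)" by (simp add: powr_powr)
  also have "\<dots> = v ^ (16 * k)" using v by (simp only: powr_log_cancel powr_realpow)
  finally show ?thesis .
qed

text \<open>The heavy event constrains one side only. Cutting that side and keeping the other whole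
  makes both the event and its complement rectangles, so the process can go on with a single
  remaining rectangle.\<close>

lemma exists_chip:
  assumes sub: "A \<subseteq> C" "B \<subseteq> C" and I: "I \<subseteq> {0..<n}" "card I \<le> d0" "agree A I" "agree B I"
    and pos: "0 < P (A \<times> B)" and nacc: "A \<times> B \<notin> Acc"
  obtains J A1 B1 A2 B2 where "J \<subseteq> {0..<n} - I" "A1 \<subseteq> A" "B1 \<subseteq> B" "A2 \<subseteq> A" "B2 \<subseteq> B"
    "A \<times> B = A1 \<times> B1 \<union> A2 \<times> B2" "(A1 \<times> B1) \<inter> (A2 \<times> B2) = {}"
    "agree A1 J \<or> agree B1 J" "P (A \<times> B) * v ^ (16 * card J) < P (A1 \<times> B1)"
proof -
  have "\<exists>J z. J \<subseteq> {0..<n} - I \<and>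
      (P (A \<times> B) * v ^ (16 * card J) < P ({a \<in> A. restrict a J = z} \<times> B) \<or>
       P (A \<times> B) * v ^ (16 * card J) < P (A \<times> {b \<in> B. restrict b J = z}))"
    using mem_AccI[OF sub I pos] nacc unfolding entropy_threshold by (meson not_le)
  then obtain J z where J: "J \<subseteq> {0..<n} - I" and
    "P (A \<times> B) * v ^ (16 * card J) < P ({a \<in> A. restrict a J = z} \<times> B) \<or>
       P (A \<times> B) * v ^ (16 * card J) < P (A \<times> {b \<in> B. restrict b J = z})"
    by blast
  then show ?thesis
  proof (elim disjE)
    assume "P (A \<times> B) * v ^ (16 * card J) < P ({a \<in> A. restrict a J = z} \<times> B)"
    then show ?thesis
      by (intro that[OF J, of "{a \<in> A. restrict a J = z}" B "{a \<in> A. restrict a J \<noteq> z}" B])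
        (auto intro: agree_restrict)
  next
    assume "P (A \<times> B) * v ^ (16 * card J) < P (A \<times> {b \<in> B. restrict b J = z})"
    then show ?thesis
      by (intro that[OF J, of A "{b \<in> B. restrict b J = z}" A "{b \<in> B. restrict b J \<noteq> z}"])
        (auto intro: agree_restrict)
  qed
qed

text \<open>One side is already fixed on \<open>J\<close>; sorting the other by its values on
  \<open>J\<close> fixes both sides on the same coordinates, which is what alignment requires. The
  price is one piece for each point of \<open>cube J q\<close>.\<close>

lemma split_chip:
  assumes sub: "A \<subseteq> C" "B \<subseteq> C" and J: "J \<subseteq> {0..<n}" and ag: "agree A J \<or> agree B J"
  obtains A' B' where "\<forall>z. A' z \<subseteq> A" "\<forall>z. B' z \<subseteq> B" "\<forall>z. agree (A' z) J" "\<forall>z. agree (B' z) J"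
    "A \<times> B = (\<Union>z\<in>cube J q. A' z \<times> B' z)"
    "\<forall>y z. y \<noteq> z \<longrightarrow> (A' y \<times> B' y) \<inter> (A' z \<times> B' z) = {}"
  using ag
proof (elim disjE)
  assume "agree A J"
  then show ?thesis
    using restrict_in_cube[OF _ J] sub
    by (intro that[of "\<lambda>_. A" "\<lambda>z. {b \<in> B. restrict b J = z}"]) (auto intro: agree_restrict)
next
  assume "agree B J"
  then show ?thesis
    using restrict_in_cube[OF _ J] sub
    by (intro that[of "\<lambda>z. {a \<in> A. restrict a J = z}" "\<lambda>_. B"]) (auto intro: agree_restrict)
qed

text \<open>The number \<open>q ^ k\<close> of pieces consumes \<open>v ^ (20 * k)\<close> of the a
  priori bound on each piece, and 38 - 20 = 18.\<close>

lemma q_pow_mult: "real q ^ k * v ^ (38 * k) = v ^ (18 * k)"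
proof -
  have "real q ^ k * v ^ (38 * k) = (real q * v ^ 20) ^ k * v ^ (18 * k)"
    by (simp add: power_mult_distrib power_mult[symmetric] power_add[symmetric])
  then show ?thesis by (simp add: qv)
qed

text \<open>A rectangle containing a heavy part is necessarily light: this is where the gap
  1.9 - 0.8 - 1 = 0.1 in the exponents enters.\<close>

lemma chip_decomposition:
  assumes sub: "A \<subseteq> C" "B \<subseteq> C" and I: "I \<subseteq> {0..<n}" "card I \<le> d0" "agree A I" "agree B I"
    and pos: "0 < P (A \<times> B)" and nacc: "A \<times> B \<notin> Acc"
  obtains J A2 B2 A' B' R where "J \<subseteq> {0..<n} - I" "J \<noteq> {}" "A2 \<subseteq> A" "B2 \<subseteq> B"
    "A \<times> B = R \<union> A2 \<times> B2" "R \<inter> (A2 \<times> B2) = {}"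
    "P (A \<times> B) * v ^ (16 * card J) < P R"
    "P (A \<times> B) < T * v ^ (38 * card I) * v ^ (2 * card J)"
    "\<forall>z. A' z \<subseteq> A" "\<forall>z. B' z \<subseteq> B" "\<forall>z. agree (A' z) (I \<union> J)" "\<forall>z. agree (B' z) (I \<union> J)"
    "R = (\<Union>z\<in>cube J q. A' z \<times> B' z)"
    "\<forall>y z. y \<noteq> z \<longrightarrow> (A' y \<times> B' y) \<inter> (A' z \<times> B' z) = {}"
proof -
  obtain J A1 B1 A2 B2 where c: "J \<subseteq> {0..<n} - I" "A1 \<subseteq> A" "B1 \<subseteq> B" "A2 \<subseteq> A" "B2 \<subseteq> B"
    "A \<times> B = A1 \<times> B1 \<union> A2 \<times> B2" "(A1 \<times> B1) \<inter> (A2 \<times> B2) = {}"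
    "agree A1 J \<or> agree B1 J" "P (A \<times> B) * v ^ (16 * card J) < P (A1 \<times> B1)"
    by (rule exists_chip[OF assms])
  have sub1: "A1 \<subseteq> C" "B1 \<subseteq> C" and Jn: "J \<subseteq> {0..<n}" using c sub by auto
  obtain A' B' where s: "\<forall>z. A' z \<subseteq> A1" "\<forall>z. B' z \<subseteq> B1" "\<forall>z. agree (A' z) J" "\<forall>z. agree (B' z) J"
    "A1 \<times> B1 = (\<Union>z\<in>cube J q. A' z \<times> B' z)"
    "\<forall>y z. y \<noteq> z \<longrightarrow> (A' y \<times> B' y) \<inter> (A' z \<times> B' z) = {}"
    by (rule split_chip[OF sub1 Jn c(8)])
  have finJ: "finite J" "finite I" using Jn I(1) finite_subset by auto
  have cardU: "card (I \<union> J) = card I + card J"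
    using c(1) finJ by (intro card_Un_disjoint) auto
  have ag: "\<forall>z. agree (A' z) (I \<union> J)" "\<forall>z. agree (B' z) (I \<union> J)"
    using s(1-4) c(2,3) I(3,4) by (meson agree_Un agree_subset subset_trans)+
  have sub': "\<forall>z. A' z \<subseteq> A" "\<forall>z. B' z \<subseteq> B"
    using s(1,2) c(2,3) by blast+
  have "P (A1 \<times> B1) = (\<Sum>z\<in>cube J q. P (A' z \<times> B' z))"
    unfolding s(5) using s(6) finite_cube[OF finJ(1)] by (intro P_UN) auto
  also have "\<dots> \<le> (\<Sum>z\<in>cube J q. T * v ^ (38 * card (I \<union> J)))"
    using s(1,2) sub1 ag I(1) Jn by (intro sum_mono spread) blast+
  also have "\<dots> = T * v ^ (38 * card I) * (real q ^ card J * v ^ (38 * card J))"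
    using finJ by (simp add: card_cube cardU algebra_simps power_add)
  also have "\<dots> = T * v ^ (38 * card I) * v ^ (18 * card J)"
    by (simp only: q_pow_mult)
  \<comment> \<open>Of the exponent 18, the part 16 cancels against the heaviness threshold; the
    remaining 2 is 20 times the gap 0.1.\<close>
  also have "\<dots> = T * v ^ (38 * card I) * v ^ (2 * card J) * v ^ (16 * card J)"
    by (simp add: power_add[symmetric])
  finally have "P (A \<times> B) * v ^ (16 * card J)
      < T * v ^ (38 * card I) * v ^ (2 * card J) * v ^ (16 * card J)"
    using c(9) by linarith
  then have light: "P (A \<times> B) < T * v ^ (38 * card I) * v ^ (2 * card J)"
    using v by simp
  \<comment> \<open>For empty \<open>J\<close> the threshold would be the mass of the whole
    rectangle, which a part cannot exceed.\<close>
  have "P (A1 \<times> B1) \<le> P (A \<times> B)" using c(2,3) by (intro P_mono) auto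
  then have "J \<noteq> {}" using c(9) by auto
  then show ?thesis
    by (rule that[OF c(1) _ c(4,5,6,7,9) light sub' ag s(5,6)])
qed

section \<open>Error budget and the recursion on it\<close>

text \<open>The target error. Since \<open>0 ^ 0 = 1\<close>, an exhausted budget allows the whole a
  priori mass to become an error.\<close>

definition err :: "nat \<Rightarrow> real" where
  "err d = (real d * v) ^ d"

text \<open>For \<open>2 \<le> d\<close> this is the value of
  \<open>v ^ (2 * k) * err (d - k)\<close> at \<open>k = 1\<close>, the largest over
  \<open>1 \<le> k < d\<close>. It is the cost per unit of relative mass split off.\<close>

definition slack :: "nat \<Rightarrow> real" where
  "slack d = v ^ (d + 1) * (real d - 1) ^ (d - 1)"

lemma err_le_slack:
  assumes "1 \<le> k" "k < d"
  shows "v ^ (2 * k) * err (d - k) \<le> slack d"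
proof -
  have "v ^ (2 * k) * err (d - k) = v ^ (d + k) * real (d - k) ^ (d - k)"
    using assms by (simp add: err_def power_mult_distrib power_add[symmetric] add.commute)
  also have "\<dots> \<le> v ^ (d + 1) * (real d - 1) ^ (d - 1)"
  proof (intro mult_mono)
    show "v ^ (d + k) \<le> v ^ (d + 1)" using assms v by (intro power_decreasing) auto
    have "real (d - k) ^ (d - k) \<le> (real d - 1) ^ (d - k)"
      using assms by (intro power_mono) auto
    also have "\<dots> \<le> (real d - 1) ^ (d - 1)"
      using assms by (intro power_increasing) auto
    finally show "real (d - k) ^ (d - k) \<le> (real d - 1) ^ (d - 1)" .
  qed (use v in auto)
  finally show ?thesis by (simp add: slack_def)
qed

text \<open>The stopping mass plus the total cost over the full range of the potential fits into the
  target. After factoring out \<open>v ^ d\<close>, the bound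
  \<open>ln (1 / v) \<le> 1 / v - 1\<close> reduces \<open>v\<close> times the bracket to at most
  \<open>2 * (real d - 1)\<close>, and \<open>double_pow_le_pow\<close> concludes.\<close>

lemma err_recursion:
  assumes "2 \<le> d"
  shows "v ^ (2 * d) + slack d * (1 + 2 * (real d - 1) * ln (1 / v)) \<le> err d"
proof -
  define p where "p = (real d - 1) ^ (d - 1)"
  define L where "L = 1 + 2 * (real d - 1) * ln (1 / v)"
  have p: "0 \<le> p" using assms by (simp add: p_def)
  have "ln (1 / v) \<le> 1 / v - 1" using v by (intro ln_le_minus_one) auto
  then have "v * L \<le> v * (1 + 2 * (real d - 1) * (1 / v - 1))"
    unfolding L_def using v assms by (intro mult_left_mono add_left_mono) auto
  also have "\<dots> = 2 * (real d - 1) - v * (2 * real d - 3)"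
    using v by (simp add: field_simps)
  also have "\<dots> \<le> 2 * (real d - 1)" using v assms by simp
  finally have 1: "p * (v * L) \<le> p * (2 * (real d - 1))"
    using p by (rule mult_left_mono)
  have "v ^ d \<le> 1" using v by (simp add: power_le_one)
  moreover have "1 + p * (2 * (real d - 1)) \<le> real d ^ d"
    using double_pow_le_pow[OF assms] by (simp add: p_def mult_ac)
  ultimately have "v ^ d + p * (v * L) \<le> real d ^ d"
    using 1 by linarith
  then have "v ^ d * (v ^ d + p * (v * L)) \<le> v ^ d * real d ^ d"
    using v by (intro mult_left_mono) auto
  moreover have "v ^ (2 * d) + slack d * L = v ^ d * (v ^ d + p * (v * L))"
    unfolding slack_def p_def[symmetric] by (simp add: power_mult power2_eq_square algebra_simps flip: power_mult_distrib)
  moreover have "err d = v ^ d * real d ^ d"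
    by (simp add: err_def power_mult_distrib)
  ultimately show ?thesis unfolding L_def[symmetric] by simp
qed

text \<open>Splitting off a part of mass \<open>c\<close> from a rectangle of mass \<open>m\<close> costs at most a constant
  times \<open>c / m \<le> ln m - ln (m - c)\<close>, so the logarithm of the remaining mass serves as a potential.\<close>

lemma good_log_potential:
  fixes A B :: "(nat \<Rightarrow> nat) set"
  assumes I: "I \<subseteq> {0..<n}" "card I + d \<le> d0"
    and IH: "\<And>e A B I. e < d \<Longrightarrow> A \<subseteq> C \<Longrightarrow> B \<subseteq> C \<Longrightarrow> I \<subseteq> {0..<n} \<Longrightarrow> card I + e \<le> d0 \<Longrightarrow>
           agree A I \<Longrightarrow> agree B I \<Longrightarrow> good (A \<times> B) (T * v ^ (38 * card I) * err e)"
    and TI: "TI = T * v ^ (38 * card I)" and \<epsilon>: "\<epsilon> = TI * v ^ (2 * d)"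
    and sub: "A \<subseteq> C" "B \<subseteq> C" and ag: "agree A I" "agree B I" and m: "\<epsilon> < P (A \<times> B)"
  shows "good (A \<times> B) (\<epsilon> + TI * slack d * (1 + ln (P (A \<times> B) / \<epsilon>)))"
  using sub ag m
\<comment> \<open>The remaining rectangle has fewer points, while \<open>I\<close>, \<open>d\<close>
  and \<open>\<epsilon>\<close> are unchanged.\<close>
proof (induction "card (A \<times> B)" arbitrary: A B rule: less_induct)
  case less
  note sub = less.prems(1,2) and ag = less.prems(3,4) and m = less.prems(5)
  have TIpos: "0 < TI" using T v TI by simp
  have \<epsilon>pos: "0 < \<epsilon>" using TIpos v \<epsilon> by simp
  let ?m = "P (A \<times> B)"
  have mpos: "0 < ?m" using m \<epsilon>pos by linarith
  have lnpos: "0 \<le> ln (?m / \<epsilon>)" using m \<epsilon>pos by simp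
  show ?case
  proof (cases "A \<times> B \<in> Acc")
    case True
    have "d = 0 \<Longrightarrow> False"
      using m spread[OF sub I(1) ag] TI \<epsilon> by simp
    then have "0 \<le> slack d" using v by (cases d) (auto simp: slack_def)
    then have "0 \<le> \<epsilon> + TI * slack d * (1 + ln (?m / \<epsilon>))"
      using lnpos TIpos \<epsilon>pos by (intro add_nonneg_nonneg mult_nonneg_nonneg) auto
    then show ?thesis using good_Acc[OF True] good_mono by blast
  next
    case False
    have cI: "card I \<le> d0" using I(2) by simp
    obtain J A2 B2 A' B' R where c: "J \<subseteq> {0..<n} - I" "J \<noteq> {}" "A2 \<subseteq> A" "B2 \<subseteq> B"
      "A \<times> B = R \<union> A2 \<times> B2" "R \<inter> (A2 \<times> B2) = {}"
      "?m * v ^ (16 * card J) < P R"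
      "?m < T * v ^ (38 * card I) * v ^ (2 * card J)"
      "\<forall>z. A' z \<subseteq> A" "\<forall>z. B' z \<subseteq> B" "\<forall>z. agree (A' z) (I \<union> J)" "\<forall>z. agree (B' z) (I \<union> J)"
      "R = (\<Union>z\<in>cube J q. A' z \<times> B' z)"
      "\<forall>y z. y \<noteq> z \<longrightarrow> (A' y \<times> B' y) \<inter> (A' z \<times> B' z) = {}"
      by (rule chip_decomposition[OF sub I(1) cI ag mpos False])
    define k where "k = card J"
    have finJ: "finite J" "finite I" using c(1) I(1) finite_subset[of _ "{0..<n}"] by auto
    have k1: "1 \<le> k" using finJ c(2) by (simp add: k_def Suc_le_eq card_gt_0_iff)
    \<comment> \<open>The stopping mass \<open>\<epsilon>\<close> is the lightness bound at
      \<open>k = d\<close>; a rectangle heavier than \<open>\<epsilon>\<close> therefore forces a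
      smaller \<open>k\<close>.\<close>
    have kd: "k < d"
    proof (rule ccontr)
      assume "\<not> k < d"
      then have "TI * v ^ (2 * k) \<le> TI * v ^ (2 * d)"
        using v TIpos by (intro mult_left_mono power_decreasing) auto
      then show False using c(8) m TI \<epsilon> by (simp add: k_def)
    qed
    have cardU: "card (I \<union> J) = card I + k"
      using c(1) finJ unfolding k_def by (intro card_Un_disjoint) auto
    have slack0: "0 \<le> slack d" using v kd by (simp add: slack_def)
    have fin: "finite (A \<times> B)"
      using sub finite_cube[of "{0..<n}" q] by (meson finite_SigmaI finite_atLeastLessThan finite_subset)
    \<comment> \<open>Each piece fixes \<open>k\<close> more coordinates and keeps budget
      \<open>d - k\<close>, so the sum of both stays within \<open>d0\<close>.\<close>
    have cost: "good R (real (card (cube J q)) * (T * v ^ (38 * card (I \<union> J)) * err (d - k)))"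
      unfolding c(13)
    proof (rule good_UN[OF finite_cube[OF finJ(1)]])
      fix z
      show "good (A' z \<times> B' z) (T * v ^ (38 * card (I \<union> J)) * err (d - k))"
        using c(1,9-12) sub k1 kd I cardU by (intro IH) (auto, blast+)
    qed (use c(14) in auto)
    have "real (card (cube J q)) * (T * v ^ (38 * card (I \<union> J)) * err (d - k))
        = TI * err (d - k) * (real q ^ k * v ^ (38 * k))"
      using finJ by (simp add: card_cube cardU TI power_add k_def algebra_simps)
    \<comment> \<open>The factor \<open>v ^ (16 * k)\<close> is at most the relative mass
      \<open>P R / ?m\<close> by heaviness; \<open>v ^ (2 * k)\<close> is kept to bring
      \<open>err (d - k)\<close> below \<open>slack d\<close>.\<close>
    also have "\<dots> = TI * (v ^ (2 * k) * err (d - k)) * v ^ (16 * k)"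
      unfolding q_pow_mult by (simp add: power_add[symmetric])
    also have "\<dots> \<le> TI * slack d * (P R / ?m)"
    proof (intro mult_mono mult_left_mono err_le_slack k1 kd)
      show "v ^ (16 * k) \<le> P R / ?m"
        using c(7) mpos by (simp add: k_def field_simps)
    qed (use TIpos v slack0 in \<open>auto simp: err_def\<close>)
    finally have gR: "good R (TI * slack d * (P R / ?m))"
      by (rule good_mono[OF cost])
    have split: "?m = P R + P (A2 \<times> B2)" unfolding c(5) by (rule P_Un[OF c(6)])
    have "0 < ?m * v ^ (16 * card J)" using mpos v by simp
    then have Rpos: "0 < P R" using c(7) by linarith
    show ?thesis
    proof (cases "\<epsilon> < P (A2 \<times> B2)")
      case True
      have "R \<noteq> {}" using Rpos by auto
      then have "A2 \<times> B2 \<subset> A \<times> B" using c(5,6) by blast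
      then have "card (A2 \<times> B2) < card (A \<times> B)" using fin by (rule psubset_card_mono[rotated])
      then have "good (A2 \<times> B2) (\<epsilon> + TI * slack d * (1 + ln (P (A2 \<times> B2) / \<epsilon>)))"
        using True sub c(3,4) ag by (intro less.hyps) (auto intro: agree_subset)
      from good_Un[OF gR this c(6)]
      have "good (A \<times> B) (\<epsilon> + TI * slack d * (P R / ?m + 1 + ln (P (A2 \<times> B2) / \<epsilon>)))"
        using c(5) by (simp add: algebra_simps)
      moreover have "P R / ?m + 1 + ln (P (A2 \<times> B2) / \<epsilon>) \<le> 1 + ln (?m / \<epsilon>)"
        using ln_ge_diff_quotient[of "P R" ?m] Rpos split True \<epsilon>pos mpos by (simp add: ln_div)
      ultimately show ?thesis
        using TIpos slack0 by (elim good_mono) (intro add_left_mono mult_left_mono, auto)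
    next
      case False
      have "good (A \<times> B) (TI * slack d * (P R / ?m) + P (A2 \<times> B2))"
        using good_Un[OF gR good_self c(6)] c(5) by simp
      \<comment> \<open>The last part may take almost all of the mass, so the logarithm cannot pay
        for it. Its relative mass is at most 1, which is the extra 1 in the potential; the remainder
        is the summand \<open>\<epsilon>\<close>.\<close>
      moreover have "P R / ?m \<le> 1 + ln (?m / \<epsilon>)"
        using lnpos split mpos P_nonneg[of "A2 \<times> B2"] by (simp add: add_increasing2)
      then have "TI * slack d * (P R / ?m) \<le> TI * slack d * (1 + ln (?m / \<epsilon>))"
        using TIpos slack0 by (intro mult_left_mono) auto
      ultimately show ?thesis
        using False by (elim good_mono) linarith
    qed
  qed
qed

text \<open>Strong induction on the budget \<open>d\<close>: the induction hypothesis serves the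
  pieces with more fixed coordinates, and \<open>good_log_potential\<close> runs the whole process
  at the present \<open>I\<close>.\<close>

lemma good_rectangle:
  "A \<subseteq> C \<Longrightarrow> B \<subseteq> C \<Longrightarrow> I \<subseteq> {0..<n} \<Longrightarrow> card I + d \<le> d0 \<Longrightarrow> agree A I \<Longrightarrow> agree B I \<Longrightarrow>
     good (A \<times> B) (T * v ^ (38 * card I) * err d)"
proof (induction d arbitrary: A B I rule: less_induct)
  case (less d)
  note sub = less.prems(1,2) and I = less.prems(3,4) and ag = less.prems(5,6)
  define TI where "TI = T * v ^ (38 * card I)"
  define \<epsilon> where "\<epsilon> = TI * v ^ (2 * d)"
  let ?m = "P (A \<times> B)"
  have TIpos: "0 < TI" using T v by (simp add: TI_def)
  have \<epsilon>pos: "0 < \<epsilon>" using TIpos v by (simp add: \<epsilon>_def)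
  have mT: "?m \<le> TI" unfolding TI_def by (rule spread[OF sub I(1) ag])
  have err0: "0 \<le> err d" using v by (simp add: err_def)
  have "good (A \<times> B) (TI * err d)"
  proof (cases "?m \<le> \<epsilon>")
    case True
    have "v ^ (2 * d) \<le> err d"
    proof (cases "d = 0")
      case False
      have "v ^ (2 * d) \<le> v ^ d" using v by (intro power_decreasing) auto
      also have "\<dots> \<le> err d" using False v unfolding err_def by (intro power_mono) auto
      finally show ?thesis .
    qed (simp add: err_def)
    then have "\<epsilon> \<le> TI * err d" unfolding \<epsilon>_def using TIpos by simp
    then show ?thesis using True good_self good_mono by (meson order.trans)
  next
    case False
    then have m: "\<epsilon> < ?m" by simp
    show ?thesis
    proof (cases "A \<times> B \<in> Acc")
      case True
      then show ?thesis using good_Acc good_mono TIpos err0 by (meson less_imp_le mult_nonneg_nonneg)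
    next
      case False
      have mpos: "0 < ?m" using m \<epsilon>pos by linarith
      have cI: "card I \<le> d0" using I(2) by simp
      \<comment> \<open>Only the mass bound is taken from this decomposition. As \<open>J\<close> is
        nonempty, the potential starts at \<open>TI * v ^ 2\<close> rather than \<open>TI\<close>;
        this gives the factor \<open>real d - 1\<close> needed in
        \<open>err_recursion\<close>.\<close>
      obtain J where J: "J \<subseteq> {0..<n} - I" "J \<noteq> {}" "?m < TI * v ^ (2 * card J)"
        unfolding TI_def by (rule chip_decomposition[OF sub I(1) cI ag mpos False])
      have k1: "1 \<le> card J" using J finite_subset[of J "{0..<n}"]
        by (auto simp: Suc_le_eq card_gt_0_iff)
      then have "TI * v ^ (2 * card J) \<le> TI * v ^ 2"
        using v TIpos by (intro mult_left_mono power_decreasing) auto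
      then have mv: "?m \<le> TI * v ^ 2" using J(3) by linarith
      \<comment> \<open>For \<open>d = 0\<close> and \<open>d = 1\<close> the stopping mass is
        \<open>TI\<close> and \<open>TI * v ^ 2\<close>, both of which bound \<open>?m\<close> from
        above.\<close>
      have d2: "2 \<le> d"
      proof (rule ccontr)
        assume "\<not> 2 \<le> d"
        then have "d = 0 \<or> d = 1" by auto
        then show False using m mT mv unfolding \<epsilon>_def by auto
      qed
      have "?m / \<epsilon> \<le> TI * v ^ 2 / \<epsilon>" using mv \<epsilon>pos by (intro divide_right_mono) auto
      also have "\<dots> = (1 / v) ^ (2 * (d - 1))"
      proof -
        have "2 * d = 2 + 2 * (d - 1)" using d2 by simp
        then have "v ^ (2 * d) = v ^ 2 * v ^ (2 * (d - 1))" by (metis power_add)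
        then show ?thesis using TIpos v by (simp add: \<epsilon>_def power_one_over)
      qed
      finally have "ln (?m / \<epsilon>) \<le> ln ((1 / v) ^ (2 * (d - 1)))"
        using mpos \<epsilon>pos v by (subst ln_le_cancel_iff) auto
      also have "\<dots> = 2 * (real d - 1) * ln (1 / v)"
        using v d2 by (simp only: ln_realpow zero_less_divide_1_iff) (simp add: of_nat_diff)
      finally have l: "ln (?m / \<epsilon>) \<le> 2 * (real d - 1) * ln (1 / v)" .
      have pot: "good (A \<times> B) (\<epsilon> + TI * slack d * (1 + ln (?m / \<epsilon>)))"
        by (rule good_log_potential[OF I _ TI_def \<epsilon>_def sub ag m]) (rule less.IH)
      have "\<epsilon> + TI * slack d * (1 + ln (?m / \<epsilon>))
          \<le> \<epsilon> + TI * slack d * (1 + 2 * (real d - 1) * ln (1 / v))"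
        using l TIpos v d2 by (intro add_left_mono mult_left_mono) (auto simp: slack_def)
      also have "\<dots> = TI * (v ^ (2 * d) + slack d * (1 + 2 * (real d - 1) * ln (1 / v)))"
        by (simp add: \<epsilon>_def algebra_simps)
      also have "\<dots> \<le> TI * err d"
        using err_recursion[OF d2] TIpos by simp
      finally show ?thesis by (rule good_mono[OF pot])
    qed
  qed
  then show ?case by (simp add: TI_def)
qed

end

section \<open>From min-entropy to the final partition\<close>

text \<open>A nonempty rectangle with both sides constant on \<open>I\<close> lies in a single fibre
  of the projection to \<open>I\<close>, and the entropy assumption bounds the mass of every
  fibre.\<close>

lemma rectangle_mass_le:
  assumes nonneg: "\<forall>z\<in>dom2 {0..<n} q. 0 \<le> \<mu> z" and q: "0 < q"
    and ent: "Hinf_dens (dom2 I q) (marg n q \<mu> I) \<ge> ereal (1.9 * log 2 (real q) * real (card I) - t)"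
    and sub: "A \<subseteq> cube {0..<n} q" "B \<subseteq> cube {0..<n} q" and I: "I \<subseteq> {0..<n}"
    and ag: "agree A I" "agree B I"
  shows "dprob (dom2 {0..<n} q) \<mu> (A \<times> B)
           \<le> 2 powr (t - 1.9 * log 2 (real q) * real (card I))"
proof (cases "A \<times> B = {}")
  case True
  show ?thesis unfolding True by (simp add: dprob_def)
next
  case False
  interpret weighted_square n q 0 \<mu> by unfold_locales (use nonneg in auto)
  obtain a b where ab: "a \<in> A" "b \<in> B" using False by auto
  define z where "z = (restrict a I, restrict b I)"
  have finI: "finite I" using I finite_subset by auto
  have z: "z \<in> dom2 I q"
    unfolding z_def dom2_def using ab sub restrict_in_cube[OF _ I] by auto
  define S where "S = {(x, y). restrict x I = fst z \<and> restrict y I = snd z}"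
  have cpos: "0 < real (card (dom2 I q))"
    using q finI by (simp add: dom2_def card_cube card_cartesian_product)
  have marg: "marg n q \<mu> I z = real (card (dom2 I q)) * P S"
    by (simp add: marg_def S_def)
  have "A \<times> B \<subseteq> S"
    using agree_restrict_eq[OF ag(1) _ ab(1)] agree_restrict_eq[OF ag(2) _ ab(2)]
    unfolding S_def z_def by auto
  then have le: "P (A \<times> B) \<le> P S" by (rule P_mono)
  show ?thesis
  proof (cases "P S = 0")
    case True
    then show ?thesis using le by (simp add: order.trans[OF le])
  next
    case False
    then have Spos: "0 < P S" using P_nonneg[of S] by simp
    let ?c = "1.9 * log 2 (real q) * real (card I)"
    have "ereal (?c - t) \<le> (if marg n q \<mu> I z = 0 then \<infinity>
            else ereal (log 2 (real (card (dom2 I q)) / marg n q \<mu> I z)))"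
      using ent z unfolding Hinf_dens_def by (meson INF_lower order.trans)
    then have "?c - t \<le> log 2 (1 / P S)"
      using Spos cpos marg by simp
    then have "log 2 (P S) \<le> t - ?c" using Spos by (simp add: log_divide)
    then have "P S \<le> 2 powr (t - ?c)" using Spos by (simp add: log_le_iff)
    then show ?thesis using le by linarith
  qed
qed

text \<open>Passes from a set of rectangles to an indexed family: the sides are recovered by choice,
  and injectivity of the enumeration turns distinct indices into distinct, hence disjoint, members.
  The uncovered points form \<open>Err\<close>.\<close>

lemma (in weighted_square) good_imp_partition:
  assumes "good (C \<times> C) e"
  shows "\<exists>(N::nat) (A :: nat \<Rightarrow> (nat \<Rightarrow> nat) set) (B :: nat \<Rightarrow> (nat \<Rightarrow> nat) set) Err.
           (\<forall>i<N. A i \<subseteq> C \<and> B i \<subseteq> C)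
         \<and> Err \<subseteq> dom2 {0..<n} q
         \<and> dom2 {0..<n} q = (\<Union>i<N. A i \<times> B i) \<union> Err
         \<and> (\<forall>i<N. \<forall>j<N. i \<noteq> j \<longrightarrow> (A i \<times> B i) \<inter> (A j \<times> B j) = {})
         \<and> (\<forall>i<N. (A i \<times> B i) \<inter> Err = {})
         \<and> (\<forall>i<N. P (A i \<times> B i) > 0
                 \<and> aligned_CBD d0 n q (condX n q \<mu> (A i \<times> B i)) (condY n q \<mu> (A i \<times> B i)))
         \<and> P Err \<le> e"
proof -
  obtain F where F: "finite F" "F \<subseteq> Acc" "disjoint F" "\<Union>F \<subseteq> C \<times> C" "P (C \<times> C - \<Union>F) \<le> e"
    using assms unfolding good_def by blast
  obtain h where h: "bij_betw h {0..<card F} F"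
    using ex_bij_betw_nat_finite[OF F(1)] by blast
  have mem: "h i \<in> F" if "i < card F" for i
    using h that by (auto simp: bij_betw_def)
  have "\<forall>S\<in>F. \<exists>A B. S = A \<times> B \<and> A \<subseteq> C \<and> B \<subseteq> C \<and> 0 < P S
      \<and> aligned_CBD d0 n q (condX n q \<mu> S) (condY n q \<mu> S)"
  proof
    fix S assume "S \<in> F"
    then have "S \<in> Acc" using F(2) by blast
    then show "\<exists>A B. S = A \<times> B \<and> A \<subseteq> C \<and> B \<subseteq> C \<and> 0 < P S
        \<and> aligned_CBD d0 n q (condX n q \<mu> S) (condY n q \<mu> S)"
      unfolding Acc_def mem_Collect_eq by (elim exE conjE) (intro exI conjI; simp only:)
  qed
  then obtain A B where AB: "\<And>S. S \<in> F \<Longrightarrow> A S \<times> B S = S" "\<And>S. S \<in> F \<Longrightarrow> A S \<subseteq> C \<and> B S \<subseteq> C"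
    and acc: "\<And>S. S \<in> F \<Longrightarrow> 0 < P S \<and> aligned_CBD d0 n q (condX n q \<mu> S) (condY n q \<mu> S)"
    by metis
  have "(\<Union>i<card F. A (h i) \<times> B (h i)) = (\<Union>i<card F. h i)"
    using AB(1) mem by (intro SUP_cong) auto
  also have "\<dots> = \<Union>F" using h by (auto simp: bij_betw_def lessThan_atLeast0)
  finally have U: "(\<Union>i<card F. A (h i) \<times> B (h i)) = \<Union>F" .
  have dj: "(A (h i) \<times> B (h i)) \<inter> (A (h j) \<times> B (h j)) = {}"
    if "i < card F" "j < card F" "i \<noteq> j" for i j
  proof -
    have "h i \<noteq> h j"
      using h that by (auto simp: bij_betw_def inj_on_def)
    then show ?thesis
      using disjointD[OF F(3) mem mem] that by (simp add: AB(1) mem)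
  qed
  show ?thesis
  proof (rule exI[of _ "card F"], rule exI[of _ "\<lambda>i. A (h i)"], rule exI[of _ "\<lambda>i. B (h i)"],
      rule exI[of _ "C \<times> C - \<Union>F"], intro conjI allI impI)
    show "dom2 {0..<n} q = (\<Union>i<card F. A (h i) \<times> B (h i)) \<union> (C \<times> C - \<Union>F)"
      unfolding U dom2_def using F(4) by blast
    show "(A (h i) \<times> B (h i)) \<inter> (C \<times> C - \<Union>F) = {}" if "i < card F" for i
      unfolding AB(1)[OF mem[OF that]] using mem[OF that] by blast
    show "C \<times> C - \<Union>F \<subseteq> dom2 {0..<n} q" by (auto simp: dom2_def)
    show "A (h i) \<subseteq> C" "B (h i) \<subseteq> C" if "i < card F" for i
      using AB(2)[OF mem[OF that]] by blast+
    show "0 < P (A (h i) \<times> B (h i))"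
      "aligned_CBD d0 n q (condX n q \<mu> (A (h i) \<times> B (h i))) (condY n q \<mu> (A (h i) \<times> B (h i)))"
      if "i < card F" for i
      unfolding AB(1)[OF mem[OF that]] using acc[OF mem[OF that]] by blast+
  qed (fact dj F(5))+
qed

theorem theorem6p4:
  fixes n q d :: nat and t :: real
    and \<mu> :: "(nat \<Rightarrow> nat) \<times> (nat \<Rightarrow> nat) \<Rightarrow> real"
  assumes dens: "is_density (dom2 {0..<n} q) \<mu>"
    and ent: "\<forall>I. I \<subseteq> {0..<n} \<longrightarrow>
               Hinf_dens (dom2 I q) (marg n q \<mu> I) \<ge> ereal (1.9 * log 2 (real q) * real (card I) - t)"
  shows "\<exists>(N::nat) (A :: nat \<Rightarrow> (nat \<Rightarrow> nat) set) (B :: nat \<Rightarrow> (nat \<Rightarrow> nat) set) Err.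
           (\<forall>i<N. A i \<subseteq> cube {0..<n} q \<and> B i \<subseteq> cube {0..<n} q)
         \<and> Err \<subseteq> dom2 {0..<n} q
         \<and> dom2 {0..<n} q = (\<Union>i<N. A i \<times> B i) \<union> Err
         \<and> (\<forall>i<N. \<forall>j<N. i \<noteq> j \<longrightarrow> (A i \<times> B i) \<inter> (A j \<times> B j) = {})
         \<and> (\<forall>i<N. (A i \<times> B i) \<inter> Err = {})
         \<and> (\<forall>i<N. dprob (dom2 {0..<n} q) \<mu> (A i \<times> B i) > 0
                 \<and> aligned_CBD d n q (condX n q \<mu> (A i \<times> B i)) (condY n q \<mu> (A i \<times> B i)))
         \<and> dprob (dom2 {0..<n} q) \<mu> Err \<le> 2 powr t * (real d * real q powr (-0.05)) ^ d"
proof -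
  have dens_nonneg: "\<forall>z\<in>dom2 {0..<n} q. 0 \<le> \<mu> z"
    and total: "(\<Sum>z\<in>dom2 {0..<n} q. \<mu> z) / real (card (dom2 {0..<n} q)) = 1"
    using dens[unfolded is_density_def] by (rule conjunct1, rule conjunct2)
  interpret weighted_square n q d \<mu> by unfold_locales (use dens_nonneg in auto)
  have one: "P (C \<times> C) = 1" using total by (simp add: dprob_def dom2_def)
  have "good (C \<times> C) (2 powr t * (real d * real q powr (-0.05)) ^ d)"
  \<comment> \<open>No \<open>v\<close> satisfies \<open>q * v ^ 20 = 1\<close> here. Total mass 1
    makes the domain nonempty, so \<open>n = 0\<close>; the whole square is then acceptable, with
    only the empty \<open>J\<close> to check.\<close>
  proof (cases "q = 0")
    case True
    have "dom2 {0..<n} q \<noteq> {}" using total by auto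
    then have n: "n = 0" using True by (cases n) (auto simp: dom2_def cube_def PiE_eq_empty_iff)
    have "C \<times> C \<in> Acc"
    proof (rule mem_AccI[of _ _ "{}"])
      fix J :: "nat set" and z assume J: "J \<subseteq> {0..<n} - {}"
      have "P ({a \<in> C. restrict a J = z} \<times> C) \<le> P (C \<times> C)"
        and "P (C \<times> {b \<in> C. restrict b J = z}) \<le> P (C \<times> C)"
        by (auto intro!: P_mono)
      then show "P ({a \<in> C. restrict a J = z} \<times> C)
            \<le> P (C \<times> C) * 2 powr (- (0.8 * log 2 (real q) * real (card J)))"
        and "P (C \<times> {b \<in> C. restrict b J = z})
            \<le> P (C \<times> C) * 2 powr (- (0.8 * log 2 (real q) * real (card J)))"
        using J n by auto
    qed (auto simp: one agree_def)
    then show ?thesis using good_Acc good_mono by fastforce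
  next
    case False
    define v where "v = real q powr (-0.05)"
    have vpos: "0 < v" using False by (simp add: v_def)
    have vpow: "v ^ k = real q powr (- 0.05 * real k)" for k
      using vpos by (simp add: v_def powr_powr flip: powr_realpow)
    interpret spread_square n q d \<mu> "2 powr t" v
    proof unfold_locales
      show "v \<le> 1" using False by (simp add: v_def powr_minus inverse_le_1_iff ge_one_powr_ge_zero)
      show "real q * v ^ 20 = 1"
        unfolding vpow using False by (simp add: powr_minus)
    next
      fix A B I assume *: "A \<subseteq> C" "B \<subseteq> C" "I \<subseteq> {0..<n}" "agree A I" "agree B I"
      have "P (A \<times> B) \<le> 2 powr (t - 1.9 * log 2 (real q) * real (card I))"
        using False ent * by (intro rectangle_mass_le[OF dens_nonneg]) auto
      also have "\<dots> = 2 powr t * 2 powr (log 2 (real q) * (- 1.9 * real (card I)))"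
        by (simp add: powr_add[symmetric] mult_ac)
      also have "\<dots> = 2 powr t * (2 powr log 2 (real q)) powr (- 1.9 * real (card I))"
        by (simp add: powr_powr)
      also have "\<dots> = 2 powr t * v ^ (38 * card I)"
        unfolding vpow using False by simp
      finally show "P (A \<times> B) \<le> 2 powr t * v ^ (38 * card I)" .
    qed (use vpos in auto)
    \<comment> \<open>Starting with no fixed coordinates and full budget \<open>d\<close>, the power
      of \<open>v\<close> in front is 1 and \<open>err d\<close> is the claimed factor.\<close>
    have "good (C \<times> C) (2 powr t * v ^ (38 * card ({} :: nat set)) * err d)"
      by (rule good_rectangle) (auto simp: agree_def)
    then show ?thesis unfolding err_def by (simp add: v_def)
  qed
  then show ?thesis by (rule good_imp_partition)
qed

end
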